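(* The unique solution $(x,y,z)\in\mathbb{N}^3$ of the equation $2\cdot 3^x+2^y=z^2$ is $(x,y,z)=(0,1,2)$.
   Context: $\mathbb{N}=\{0,1,2,3,\ldots\}$ denotes the set of non-negative integers. *)

theory Defs
  imports Main
begin

end

theory Submission
  imports Defs
begin

text \<open>Modulo 4 the left-hand side is \<open>3\<close> for \<open>y = 0\<close> and \<open>2\<close> for \<open>y \<ge> 2\<close>, never a square, so
  \<open>y = 1\<close>; then for \<open>x \<ge> 1\<close> the left-hand side is \<open>2\<close> modulo 3, again not a square.\<close>

lemma square_mod_4: "(z::nat) ^ 2 mod 4 \<in> {0, 1}"
proof -
  have "z mod 4 \<in> {0, 1, 2, 3}" by auto
  then show ?thesis
    \<comment> \<open>Full instantiation keeps the reversed rule from looping; the four residues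
      have squares 0, 1, 4, 9.\<close>
    unfolding power_mod [of z 4 2, symmetric] by auto
qed

lemma square_mod_3: "(z::nat) ^ 2 mod 3 \<in> {0, 1}"
proof -
  have "z mod 3 \<in> {0, 1, 2}" by auto
  then show ?thesis
    unfolding power_mod [of z 3 2, symmetric] by auto
qed

text \<open>Tripling preserves the residue 2, since 3 * 2 = 6.\<close>

lemma two_mult_three_power_mod_4: "2 * 3 ^ x mod 4 = (2::nat)"
  by (induction x) (simp_all, presburger)

theorem theorem0p15:
  fixes x y z :: nat
  shows "2 * 3 ^ x + 2 ^ y = z ^ 2 \<longleftrightarrow> (x, y, z) = (0, 1, 2)"
proof
  assume eq: "2 * 3 ^ x + 2 ^ y = z ^ 2"
  \<comment> \<open>Replacing \<open>2 * 3 ^ x\<close> by its residue eliminates \<open>x\<close>,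
    leaving a condition on \<open>y\<close> alone.\<close>
  have mod4: "(2 + 2 ^ y) mod 4 \<in> {0, 1 :: nat}"
    using square_mod_4 [of z] two_mult_three_power_mod_4 [of x]
    unfolding eq [symmetric] by (metis mod_add_left_eq)
  have y: "y = 1"
  proof (rule ccontr)
    assume "y \<noteq> 1"
    then consider "y = 0" | k where "y = k + 2"
      by (metis One_nat_def add_2_eq_Suc' not0_implies_Suc)
    then show False
      using mod4 by cases (simp_all add: power_add, presburger)
  qed
  have x: "x = 0"
  proof (rule ccontr)
    assume "x \<noteq> 0"
    then obtain k where "x = Suc k"
      using not0_implies_Suc by blast
    \<comment> \<open>Splitting off an explicit factor 3 reduces the residue to linear arithmetic;
      the summand 2 is \<open>2 ^ y\<close>.\<close>
    then have "z ^ 2 = 3 * (2 * 3 ^ k) + 2"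
      using eq y by simp
    then have "z ^ 2 mod 3 = 2"
      by presburger
    then show False
      using square_mod_3 [of z] by simp
  qed
  have "z ^ 2 = 2 ^ 2"
    using eq x y by simp
  then have "z = 2"
    by (rule power_eq_imp_eq_base) simp_all
  with x y show "(x, y, z) = (0, 1, 2)"
    by simp
qed simp

end
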